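(* Let $(X,\|\cdot\|)$ be a real normed space equipped with a compatible regular pairing $\llbracket\cdot,\cdot\rrbracket$, and let $A$ be a bounded linear operator on $X$. Then $$\mu(A)=\sup_{x\in S_X}\|Ax\|\cos_L(x,Ax).$$ In particular, $\mu(A)\le 0$ if and only if $\angle_L(x,Ax)\ge\pi/2$ for all $x\in S_X$ with $Ax\ne 0$.
   Context: $X\neq\{0\}$, so that the unit sphere $S_X=\{x\in X:\|x\|=1\}$ is nonempty. Weak and regular pairings. A weak pairing on a real normed space $(X,\|\cdot\|)$ is a map $\llbracket\cdot,\cdot\rrbracket:X\times X\to\mathbb{R}$ that satisfies: subadditivity in the first argument, $\llbracket x_1+x_2,y\rrbracket\le\llbracket x_1,y\rrbracket+\llbracket x_2,y\rrbracket$; weak homogeneity, $\llbracket \alpha x,y\rrbracket=\llbracket x,\alpha y\rrbracket=\alpha\llbracket x,y\rrbracket$ for $\alpha\ge 0$ and $\llbracket -x,-y\rrbracket=\llbracket x,y\rrbracket$; positive definiteness, $\llbracket x,x\rrbracket>0$ for $x\ne 0$; and the Cauchy–Schwarz inequality, $|\llbracket x,y\rrbracket|\le\llbracket x,x\rrbracket^{1/2}\llbracket y,y\rrbracket^{1/2}$. It is compatible with the norm if $\llbracket x,x\rrbracket=\|x\|^2$ for all $x$. A compatible weak pairing is regular if it satisfies any of the following conditions, which are known to be equivalent: Lumer's identity $\mu(A)=\sup_{x\in S_X}\llbracket Ax,x\rrbracket$ for every bounded linear operator $A$ on $X$; the straight angle property $\llbracket -x,x\rrbracket=-\|x\|^2$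 for all $x\in X$; partial linearity $\llbracket x+ay,y\rrbracket=\llbracket x,y\rrbracket+a\|y\|^2$ for all $x,y\in X$, $a\in\mathbb{R}$. Logarithmic norm. $\mu(A)=\lim_{h\to0^+}\dfrac{\|I+hA\|-1}{h}$, with $\|\cdot\|$ the induced operator norm. Left angle. For nonzero $x,y\in X$, $\cos_L(x,y)=\dfrac{\llbracket y,x\rrbracket}{\|x\|\|y\|}\in[-1,1]$ and $\angle_L(x,y)=\arccos(\cos_L(x,y))\in[0,\pi]$. When $Ax=0$ the product $\|Ax\|\cos_L(x,Ax)$ is understood to be $0$. *)

theory Defs
  imports "HOL-Analysis.Analysis"
begin

locale weak_pairing =
  fixes W :: "'a::real_normed_vector \<Rightarrow> 'a \<Rightarrow> real"
  assumes subadditive: "W (x1 + x2) y \<le> W x1 y + W x2 y"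
    and homogeneous_left: "\<alpha> \<ge> 0 \<Longrightarrow> W (\<alpha> *\<^sub>R x) y = \<alpha> * W x y"
    and homogeneous_right: "\<alpha> \<ge> 0 \<Longrightarrow> W x (\<alpha> *\<^sub>R y) = \<alpha> * W x y"
    and minus_minus: "W (- x) (- y) = W x y"
    and positive_definite: "x \<noteq> 0 \<Longrightarrow> W x x > 0"
    and Cauchy_Schwarz: "\<bar>W x y\<bar> \<le> sqrt (W x x) * sqrt (W y y)"

locale compatible_weak_pairing = weak_pairing +
  assumes compatible: "W x x = (norm x)\<^sup>2"

definition log_norm :: "('a::real_normed_vector \<Rightarrow>\<^sub>L 'a) \<Rightarrow> real" where
  "log_norm A = Lim (at_right 0) (\<lambda>h. (norm (id_blinfun + h *\<^sub>R A) - 1) / h)"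

definition Lumer_identity :: "('a::real_normed_vector \<Rightarrow> 'a \<Rightarrow> real) \<Rightarrow> bool" where
  "Lumer_identity W \<longleftrightarrow>
    (\<forall>A :: 'a \<Rightarrow>\<^sub>L 'a. log_norm A = (SUP x\<in>sphere 0 1. W (blinfun_apply A x) x))"

definition straight_angle :: "('a::real_normed_vector \<Rightarrow> 'a \<Rightarrow> real) \<Rightarrow> bool" where
  "straight_angle W \<longleftrightarrow> (\<forall>x. W (- x) x = - (norm x)\<^sup>2)"

definition partially_linear :: "('a::real_normed_vector \<Rightarrow> 'a \<Rightarrow> real) \<Rightarrow> bool" where
  "partially_linear W \<longleftrightarrow> (\<forall>x y a. W (x + a *\<^sub>R y) y = W x y + a * (norm y)\<^sup>2)"

text \<open>
  On a nonzero space the three conditions are equivalent; regularity is defined by their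
  disjunction, so that each of them suffices and their equivalence is not presupposed.
\<close>

locale regular_pairing = compatible_weak_pairing +
  assumes regular: "Lumer_identity W \<or> straight_angle W \<or> partially_linear W"

text \<open>
  The left angle is meaningful for nonzero vectors only. Since division by zero yields zero,
  \<open>cos_left W x 0 = 0\<close>, in accordance with the convention that
  \<open>norm (A x) * cos_left W x (A x)\<close> is zero when \<open>A x = 0\<close>.
\<close>

definition cos_left :: "('a::real_normed_vector \<Rightarrow> 'a \<Rightarrow> real) \<Rightarrow> 'a \<Rightarrow> 'a \<Rightarrow> real" where
  "cos_left W x y = W y x / (norm x * norm y)"

definition angle_left :: "('a::real_normed_vector \<Rightarrow> 'a \<Rightarrow> real) \<Rightarrow> 'a \<Rightarrow> 'a \<Rightarrow> real" where
  "angle_left W x y = arccos (cos_left W x y)"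

text \<open>
  The following facts show that, on a nonzero space, the limit defining \<^const>\<open>log_norm\<close> exists,
  that the cosine lies in the domain of \<^const>\<open>arccos\<close>, and that the suprema
  are taken over nonempty bounded sets of reals, so that none of these total operators is
  used outside its meaningful range.
\<close>

lemma log_norm_tendsto:
  fixes A :: "'a::real_normed_vector \<Rightarrow>\<^sub>L 'a"
  assumes "\<exists>x::'a. x \<noteq> 0"
  shows "((\<lambda>h. (norm (id_blinfun + h *\<^sub>R A) - 1) / h) \<longlongrightarrow> log_norm A) (at_right 0)"
proof -
  define I where "I = (id_blinfun :: 'a \<Rightarrow>\<^sub>L 'a)"
  define f where "f = (\<lambda>h. (norm (I + h *\<^sub>R A) - 1) / h)"
  obtain x :: 'a where x: "x \<noteq> 0" using assms by blast
  have "norm x \<le> norm I * norm x"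
    using norm_blinfun[of I x] by (simp add: I_def)
  hence "norm I \<ge> 1" using x by simp
  moreover have "norm I \<le> 1"
    unfolding I_def by (rule norm_blinfun_bound) auto
  ultimately have nI: "norm I = 1" by simp
  have mono: "f s \<le> f t" if st: "0 < s" "s \<le> t" for s t
  proof -
    have "I + s *\<^sub>R A = (1 - s/t) *\<^sub>R I + (s/t) *\<^sub>R (I + t *\<^sub>R A)"
      using st by (simp add: algebra_simps)
    hence "norm (I + s *\<^sub>R A) \<le> norm ((1 - s/t) *\<^sub>R I) + norm ((s/t) *\<^sub>R (I + t *\<^sub>R A))"
      by (metis norm_triangle_ineq)
    also have "\<dots> = (1 - s/t) + (s/t) * norm (I + t *\<^sub>R A)"
      using st nI by simp
    finally have "norm (I + s *\<^sub>R A) - 1 \<le> (s/t) * (norm (I + t *\<^sub>R A) - 1)"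
      by (simp add: algebra_simps)
    thus ?thesis using st unfolding f_def by (simp add: field_simps)
  qed
  have lower: "- norm A \<le> f h" if "0 < h" for h
  proof -
    have "norm I \<le> norm (I + h *\<^sub>R A) + norm (h *\<^sub>R A)"
      using norm_triangle_ineq4[of "I + h *\<^sub>R A" "h *\<^sub>R A"] by simp
    thus ?thesis using that nI unfolding f_def by (simp add: field_simps)
  qed
  define L where "L = (INF h\<in>{0<..}. f h)"
  have bdd: "bdd_below (f ` {0<..})"
    by (rule bdd_belowI2[of _ "- norm A"]) (use lower in auto)
  have lim: "(f \<longlongrightarrow> L) (at_right 0)"
  proof (rule order_tendstoI)
    fix a assume "a < L"
    moreover have "L \<le> f h" if "h > 0" for h
      unfolding L_def by (rule cINF_lower[OF bdd]) (use that in auto)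
    ultimately show "\<forall>\<^sub>F h in at_right 0. a < f h"
      unfolding eventually_at_right_field by (intro exI[of _ 1]) (auto intro: less_le_trans)
  next
    fix a assume "L < a"
    then obtain t where "t > 0" "f t < a"
      unfolding L_def using cINF_less_iff[OF _ bdd] by auto
    thus "\<forall>\<^sub>F h in at_right 0. f h < a"
      unfolding eventually_at_right_field
      by (intro exI[of _ t]) (auto intro: le_less_trans[OF mono[OF _ less_imp_le]])
  qed
  have "log_norm A = L"
    unfolding log_norm_def
    using tendsto_Lim[OF _ lim] by (simp add: f_def I_def)
  thus ?thesis using lim by (simp add: f_def I_def)
qed

context compatible_weak_pairing
begin

lemma abs_pairing_le: "\<bar>W x y\<bar> \<le> norm x * norm y"
  using Cauchy_Schwarz[of x y] by (simp add: compatible)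

lemma abs_cos_left_le_1: "\<bar>cos_left W x y\<bar> \<le> 1"
  using abs_pairing_le[of y x]
  by (cases "x = 0 \<or> y = 0") (auto simp: cos_left_def abs_mult divide_le_eq mult.commute)

lemma bdd_above_pairing: "bdd_above ((\<lambda>x. W (blinfun_apply A x) x) ` sphere 0 1)"
proof (rule bdd_aboveI2)
  fix x :: 'a assume "x \<in> sphere 0 1"
  thus "W (blinfun_apply A x) x \<le> norm A"
    using abs_pairing_le[of "blinfun_apply A x" x] norm_blinfun[of A x] by simp
qed

lemma bdd_above_norm_cos_left:
  "bdd_above ((\<lambda>x. norm (blinfun_apply A x) * cos_left W x (blinfun_apply A x)) ` sphere 0 1)"
proof (rule bdd_aboveI2)
  fix x :: 'a assume "x \<in> sphere 0 1"
  moreover have "norm (blinfun_apply A x) * cos_left W x (blinfun_apply A x)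
      \<le> norm (blinfun_apply A x) * 1"
    using abs_cos_left_le_1[of x "blinfun_apply A x"] by (intro mult_left_mono) auto
  ultimately show "norm (blinfun_apply A x) * cos_left W x (blinfun_apply A x) \<le> norm A"
    using norm_blinfun[of A x] by simp
qed

end

lemma sphere_nonempty:
  assumes "\<exists>x::'a::real_normed_vector. x \<noteq> 0"
  shows "sphere (0::'a) 1 \<noteq> {}"
proof -
  obtain x :: 'a where "x \<noteq> 0" using assms by blast
  hence "sgn x \<in> sphere 0 1" by (simp add: norm_sgn)
  thus ?thesis by blast
qed

end

theory Submission
  imports Defs
begin

text \<open>
  For a unit vector \<open>x\<close> the quantity \<open>norm (A x) * cos_left W x (A x)\<close> is \<open>W (A x) x\<close>, so the
  claim is Lumer's identity. The straight angle property yields partial linearity, and from the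
  latter, \<open>1 + h * W (A x) x = W (x + h * A x) x \<le> norm (1 + h * A)\<close> gives one inequality. For the
  other one, let \<open>s\<close> be the supremum; then \<open>norm (x - h * A x) \<ge> (1 - h * s) * norm x\<close>. Applied to
  \<open>(1 + h * A) x\<close> this gives \<open>(1 - h * s) * norm (1 + h * A) \<le> 1 + h\<^sup>2 * (norm A)\<^sup>2\<close>, which avoids
  inverting \<open>1 - h * A\<close> and hence any completeness assumption.
\<close>

context weak_pairing
begin

lemma zero_left [simp]: "W 0 y = 0"
  using homogeneous_left[of 0 0 y] by simp

lemma minus_left_ge: "- W x y \<le> W (- x) y"
  using subadditive[of x "- x" y] by simp

end

context compatible_weak_pairing
begin

text \<open>The straight angle property extends homogeneity along \<open>y\<close> to negative
  coefficients, so subadditivity yields one inequality of partial linearity for every real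
  \<open>a\<close>; undoing the shift by \<open>a\<close> yields the other.\<close>

lemma straight_angle_imp_partially_linear:
  assumes "straight_angle W"
  shows "partially_linear W"
proof -
  have scale: "W (a *\<^sub>R y) y = a * (norm y)\<^sup>2" for a y
  proof (cases "a \<ge> 0")
    case True
    thus ?thesis by (simp add: homogeneous_left compatible)
  next
    case False
    hence "W ((- a) *\<^sub>R (- y)) y = (- a) * W (- y) y"
      by (intro homogeneous_left) simp
    thus ?thesis using assms by (simp add: straight_angle_def)
  qed
  have le: "W (x + a *\<^sub>R y) y \<le> W x y + a * (norm y)\<^sup>2" for x y a
    using subadditive[of x "a *\<^sub>R y" y] by (simp add: scale)
  \<comment> \<open>The second instance of \<open>le\<close> starts at the shifted vector and shifts
    back by \<open>- a\<close>, which bounds \<open>W x y\<close> from above.\<close>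
  have "W (x + a *\<^sub>R y) y = W x y + a * (norm y)\<^sup>2" for x y a
    using le[of x a y] le[of "x + a *\<^sub>R y" "- a" y] by simp
  thus ?thesis by (simp add: partially_linear_def)
qed

lemma partially_linear_pairing_le_log_norm:
  assumes "partially_linear W" and "norm x = 1"
  shows "W (blinfun_apply A x) x \<le> log_norm A"
proof -
  have "\<exists>x::'a. x \<noteq> 0"
    using assms(2) by (intro exI[of _ x]) auto
  note lim = log_norm_tendsto[OF this, of A]
  have "W (blinfun_apply A x) x \<le> (norm (id_blinfun + h *\<^sub>R A) - 1) / h" if "h > 0" for h
  proof -
    \<comment> \<open>Partial linearity along \<open>x\<close> with coefficient 1; the added term is
      1 because \<open>x\<close> is a unit vector.\<close>
    have "h * W (blinfun_apply A x) x + 1 = W (h *\<^sub>R blinfun_apply A x + 1 *\<^sub>R x) x"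
      using assms that unfolding partially_linear_def by (metis homogeneous_left less_imp_le
          mult_1 one_power2)
    also have "\<dots> \<le> norm (blinfun_apply (id_blinfun + h *\<^sub>R A) x)"
      using abs_pairing_le[of "h *\<^sub>R blinfun_apply A x + 1 *\<^sub>R x" x] assms(2)
      by (simp add: blinfun.add_left blinfun.scaleR_left add.commute)
    also have "\<dots> \<le> norm (id_blinfun + h *\<^sub>R A)"
      using norm_blinfun[of "id_blinfun + h *\<^sub>R A" x] assms(2) by simp
    finally show ?thesis using that by (simp add: field_simps)
  qed
  hence "\<forall>\<^sub>F h in at_right 0. W (blinfun_apply A x) x \<le> (norm (id_blinfun + h *\<^sub>R A) - 1) / h"
    by (auto simp: eventually_at_right_field intro: exI[of _ 1])
  thus ?thesis
    by (rule tendsto_lowerbound[OF lim]) simp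
qed

text \<open>Cauchy-Schwarz, applied to the pairing of \<open>u - h A u\<close> with the unit vector
  \<open>u = sgn x\<close>, gives the bound at \<open>u\<close>; scaling by \<open>norm x\<close>
  gives it at \<open>x\<close>.\<close>

lemma partially_linear_norm_diff_ge:
  assumes "partially_linear W" and "h \<ge> 0"
    and s: "\<And>x. norm x = 1 \<Longrightarrow> W (blinfun_apply A x) x \<le> s"
  shows "(1 - h * s) * norm x \<le> norm (x - h *\<^sub>R blinfun_apply A x)"
proof (cases "x = 0")
  case False
  define u where "u = sgn x"
  have nu: "norm u = 1" using False by (simp add: u_def norm_sgn)
  have x: "norm x *\<^sub>R u = x" using False by (simp add: u_def sgn_div_norm)
  hence Ax: "blinfun_apply A x = norm x *\<^sub>R blinfun_apply A u"
    by (metis blinfun.scaleR_right)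
  have "1 - h * s \<le> 1 - h * W (blinfun_apply A u) u"
    using s[OF nu] assms(2) by (simp add: mult_left_mono)
  \<comment> \<open>Subadditivity bounds the pairing with \<open>- A u\<close> only from below,
    which is the direction required here.\<close>
  also have "\<dots> \<le> 1 + h * W (- blinfun_apply A u) u"
    using mult_left_mono[OF minus_left_ge[of "blinfun_apply A u" u] assms(2)] by simp
  also have "\<dots> = W (h *\<^sub>R (- blinfun_apply A u) + 1 *\<^sub>R u) u"
    using assms(1,2) nu unfolding partially_linear_def
    by (metis homogeneous_left add.commute mult_1 one_power2)
  also have "\<dots> \<le> norm (u - h *\<^sub>R blinfun_apply A u)"
    using abs_pairing_le[of "h *\<^sub>R (- blinfun_apply A u) + 1 *\<^sub>R u" u] nu by simp
  finally have "(1 - h * s) * norm x \<le> norm (norm x *\<^sub>R (u - h *\<^sub>R blinfun_apply A u))"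
    by (simp add: mult.commute mult_left_mono)
  also have "norm x *\<^sub>R (u - h *\<^sub>R blinfun_apply A u) = x - h *\<^sub>R blinfun_apply A x"
    by (simp add: Ax x scaleR_diff_right mult.commute)
  finally show ?thesis .
qed simp

text \<open>To first order in \<open>h\<close>, \<open>I + h A\<close> inverts
  \<open>I - h A\<close>, so the lower bound for the latter becomes an upper bound for the norm of
  the former. The error is of order \<open>h\<^sup>2\<close> and vanishes in the limit of the
  difference quotients.\<close>

lemma partially_linear_log_norm_le:
  assumes "partially_linear W" and "\<exists>x::'a. x \<noteq> 0"
    and s: "\<And>x. norm x = 1 \<Longrightarrow> W (blinfun_apply A x) x \<le> s"
  shows "log_norm A \<le> s"
proof -
  have bound: "(norm (id_blinfun + h *\<^sub>R A) - 1) / h \<le> (h * (norm A)\<^sup>2 + s) / (1 - h * s)"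
    if h: "h > 0" "1 - h * s > 0" for h
  proof -
    have "norm (id_blinfun + h *\<^sub>R A) \<le> (1 + h\<^sup>2 * (norm A)\<^sup>2) / (1 - h * s)"
    proof (rule norm_blinfun_bound)
      fix x
      define y where "y = blinfun_apply (id_blinfun + h *\<^sub>R A) x"
      have y: "y = x + h *\<^sub>R blinfun_apply A x"
        by (simp add: y_def blinfun.add_left blinfun.scaleR_left)
      have "(1 - h * s) * norm y \<le> norm (y - h *\<^sub>R blinfun_apply A y)"
        using h by (intro partially_linear_norm_diff_ge assms) auto
      \<comment> \<open>The first-order terms cancel, since
        \<open>(I - h A)(I + h A) = I - h\<^sup>2 A\<^sup>2\<close>.\<close>
      also have "y - h *\<^sub>R blinfun_apply A y = x - h\<^sup>2 *\<^sub>R blinfun_apply A (blinfun_apply A x)"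
        by (simp add: y blinfun.add_right blinfun.scaleR_right power2_eq_square algebra_simps)
      also have "norm \<dots> \<le> norm x + h\<^sup>2 * norm (blinfun_apply A (blinfun_apply A x))"
        using norm_triangle_ineq4[of x "h\<^sup>2 *\<^sub>R blinfun_apply A (blinfun_apply A x)"] by simp
      also have "\<dots> \<le> norm x + h\<^sup>2 * (norm A * (norm A * norm x))"
        by (intro add_left_mono mult_left_mono order.trans[OF norm_blinfun] norm_blinfun) simp_all
      finally have "(1 - h * s) * norm y \<le> (1 + h\<^sup>2 * (norm A)\<^sup>2) * norm x"
        by (simp add: power2_eq_square algebra_simps)
      thus "norm (blinfun_apply (id_blinfun + h *\<^sub>R A) x)
          \<le> (1 + h\<^sup>2 * (norm A)\<^sup>2) / (1 - h * s) * norm x"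
        using h by (simp add: y_def field_simps)
    qed (use h in simp)
    hence "norm (id_blinfun + h *\<^sub>R A) - 1 \<le> (h\<^sup>2 * (norm A)\<^sup>2 + h * s) / (1 - h * s)"
      using h by (simp add: field_simps)
    also have "\<dots> = (h * (norm A)\<^sup>2 + s) / (1 - h * s) * h"
      by (simp add: power2_eq_square algebra_simps)
    finally show ?thesis using h by (simp only: pos_divide_le_eq)
  qed
  \<comment> \<open>For positive \<open>s\<close> the denominator is positive only for small
    \<open>h\<close>, so \<open>bound\<close> is available only eventually.\<close>
  have "((\<lambda>h. 1 - h * s) \<longlongrightarrow> 1) (at_right 0)"
    by (auto intro!: tendsto_eq_intros)
  hence "\<forall>\<^sub>F h in at_right 0. 0 < 1 - h * s"
    by (rule order_tendstoD) simp
  hence "\<forall>\<^sub>F h in at_right 0.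
      (norm (id_blinfun + h *\<^sub>R A) - 1) / h \<le> (h * (norm A)\<^sup>2 + s) / (1 - h * s)"
    using eventually_at_right_less[of "0::real"] by eventually_elim (rule bound)
  moreover have "((\<lambda>h. (h * (norm A)\<^sup>2 + s) / (1 - h * s)) \<longlongrightarrow> s) (at_right 0)"
    by (auto intro!: tendsto_eq_intros)
  ultimately show ?thesis
    using log_norm_tendsto[OF assms(2)] by (intro tendsto_le) auto
qed

lemma partially_linear_imp_Lumer_identity:
  assumes "partially_linear W" and "\<exists>x::'a. x \<noteq> 0"
  shows "Lumer_identity W"
  unfolding Lumer_identity_def
proof (intro allI antisym)
  fix A :: "'a \<Rightarrow>\<^sub>L 'a"
  show "log_norm A \<le> (SUP x\<in>sphere 0 1. W (blinfun_apply A x) x)"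
    by (intro partially_linear_log_norm_le assms cSUP_upper bdd_above_pairing) simp
  show "(SUP x\<in>sphere 0 1. W (blinfun_apply A x) x) \<le> log_norm A"
    using assms by (intro cSUP_least sphere_nonempty partially_linear_pairing_le_log_norm) auto
qed

lemma norm_mult_cos_left:
  assumes "norm x = 1"
  shows "norm y * cos_left W x y = W y x"
  using assms by (cases "y = 0") (simp_all add: cos_left_def)

lemma angle_left_ge_pi_half_iff:
  assumes "x \<noteq> 0" and "y \<noteq> 0"
  shows "angle_left W x y \<ge> pi / 2 \<longleftrightarrow> W y x \<le> 0"
proof -
  have "angle_left W x y \<ge> pi / 2 \<longleftrightarrow> cos_left W x y \<le> 0"
    \<comment> \<open>\<open>arccos\<close> is decreasing on \<open>[-1, 1]\<close> and takes the
      value \<open>pi / 2\<close> at 0.\<close>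
    using arccos_le_mono[of 0 "cos_left W x y"] abs_cos_left_le_1[of x y]
    by (simp add: angle_left_def)
  also have "\<dots> \<longleftrightarrow> W y x \<le> 0"
    using assms by (simp add: cos_left_def pos_divide_le_eq)
  finally show ?thesis .
qed

end

text \<open>Each alternative of \<open>regular\<close> leads here: the straight angle property goes
  through partial linearity.\<close>

lemma (in regular_pairing) Lumer_identity:
  assumes "\<exists>x::'a. x \<noteq> 0"
  shows "Lumer_identity W"
  using regular straight_angle_imp_partially_linear partially_linear_imp_Lumer_identity assms
  by blast

theorem proposition1:
  fixes W :: "'a::real_normed_vector \<Rightarrow> 'a \<Rightarrow> real"
    and A :: "'a \<Rightarrow>\<^sub>L 'a"
  assumes nontrivial: "\<exists>x::'a. x \<noteq> 0"
    and regular: "regular_pairing W"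
  shows "log_norm A =
      (SUP x\<in>sphere 0 1. norm (blinfun_apply A x) * cos_left W x (blinfun_apply A x)) \<and>
    (log_norm A \<le> 0 \<longleftrightarrow>
      (\<forall>x\<in>sphere 0 1. blinfun_apply A x \<noteq> 0 \<longrightarrow> angle_left W x (blinfun_apply A x) \<ge> pi / 2))"
proof -
  interpret regular_pairing W by (rule regular)
  have Lumer: "log_norm A = (SUP x\<in>sphere 0 1. W (blinfun_apply A x) x)"
    using Lumer_identity[OF nontrivial] by (simp add: Lumer_identity_def)
  also have "\<dots> = (SUP x\<in>sphere 0 1. norm (blinfun_apply A x) * cos_left W x (blinfun_apply A x))"
    by (intro SUP_cong refl) (simp add: norm_mult_cos_left)
  finally have eq: "log_norm A =
    (SUP x\<in>sphere 0 1. norm (blinfun_apply A x) * cos_left W x (blinfun_apply A x))" .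
  have "log_norm A \<le> 0 \<longleftrightarrow> (\<forall>x\<in>sphere 0 1. W (blinfun_apply A x) x \<le> 0)"
    unfolding Lumer by (rule cSUP_le_iff[OF sphere_nonempty[OF nontrivial] bdd_above_pairing])
  also have "\<dots> \<longleftrightarrow> (\<forall>x\<in>sphere 0 1. blinfun_apply A x \<noteq> 0 \<longrightarrow>
      angle_left W x (blinfun_apply A x) \<ge> pi / 2)"
  \<comment> \<open>If \<open>A x = 0\<close>, both sides hold: the pairing is 0 by
    \<open>zero_left\<close>, and the angle condition is vacuous.\<close>
  proof (intro ball_cong refl)
    fix x :: 'a
    assume "x \<in> sphere 0 1"
    hence "x \<noteq> 0" by auto
    thus "W (blinfun_apply A x) x \<le> 0 \<longleftrightarrow>
        (blinfun_apply A x \<noteq> 0 \<longrightarrow> angle_left W x (blinfun_apply A x) \<ge> pi / 2)"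
      using angle_left_ge_pi_half_iff[of x "blinfun_apply A x"]
      by (cases "blinfun_apply A x = 0") simp_all
  qed
  finally show ?thesis using eq by blast
qed

end
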